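(* Suppose $r$ is a positive integer and $c\in\mathbb Z$ with $c\neq 0$. Let $b(n)$ be a polynomial in $n$ with integral coefficients and the property $b(-1-n)=(-1)^rb(n)$ for any $n\in\mathbb Z$. Define the sequence $\{u_n\}_{n\ge 0}$ of rational numbers by $$u_0=1,\quad u_1=b(0)\quad\text{and}\quad (n+1)^ru_{n+1}=b(n)u_n-cn^ru_{n-1}\quad (n\ge 1).$$ Then $$\sum_{k=0}^{n-1}b(k)(-c)^{n-1-k}u_k^2=n^ru_nu_{n-1}\quad(n=1,2,3,\ldots).$$ Thus, if $p$ is an odd prime, $p\nmid c$ and $u_m\in\mathbb Z_p$ for every positive integer $m$, then $$\sum_{k=0}^{p-1}\frac{b(k)}{(-c)^k}u_k^2\equiv 0\pmod{p^r}.$$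
   Context: $\mathbb Z_p$ denotes the set of rational numbers whose denominator is not divisible by $p$; congruences modulo powers of $p$ are taken in this ring. *)

theory Defs
  imports Complex_Main "HOL-Computational_Algebra.Computational_Algebra"
begin

(* The ring of p-integral rationals (the localization of the integers at p, not the p-adic
   integers). The second component of quotient_of is the positive denominator in lowest terms. *)
definition p_integral :: "nat \<Rightarrow> rat set" where
  "p_integral p = {x. \<not> int p dvd snd (quotient_of x)}"

(* Congruence in the ring p_integral p modulo its ideal generated by p ^ r. *)
definition p_cong :: "nat \<Rightarrow> nat \<Rightarrow> rat \<Rightarrow> rat \<Rightarrow> bool" where
  "p_cong p r x y \<longleftrightarrow>
     x \<in> p_integral p \<and> y \<in> p_integral p \<and>
     (\<exists>z\<in>p_integral p. x - y = of_nat p ^ r * z)"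

end

theory Submission
  imports Defs
begin

text \<open>Write S(n) for the sum over k \<le> n of B(k) (-c)^(n-k) u(k)^2. Passing from n to n+1
  multiplies S(n) by -c and adds B(n+1) u(n+1)^2. If S(n) = (n+1)^r u(n+1) u(n), then u(n+1) factors
  out, and the cofactor is exactly the right-hand side of the recurrence at n+1; so the identity
  follows by induction (\<open>sum_recurrence_squares\<close>). For the congruence, take the
  identity with p terms and divide by (-c)^(p-1), a unit among the p-integral rationals because p
  does not divide c. The sum becomes p^r times a product of p-integral numbers
  (\<open>p_cong_power_mult_0\<close>, \<open>p_integral_mult\<close>).\<close>

lemma p_integral_iff:
  "x \<in> p_integral p \<longleftrightarrow> (\<exists>a d. \<not> int p dvd d \<and> x = of_int a / of_int d)"
proof
  assume "x \<in> p_integral p"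
  then show "\<exists>a d. \<not> int p dvd d \<and> x = of_int a / of_int d"
    unfolding p_integral_def
    by (metis Fract_of_int_quotient mem_Collect_eq prod.collapse quotient_of_div)
next
  assume "\<exists>a d. \<not> int p dvd d \<and> x = of_int a / of_int d"
  then obtain a d where d: "\<not> int p dvd d" and x: "x = of_int a / of_int d"
    by blast
  obtain m n where mn: "quotient_of x = (m, n)"
    by fastforce
  then have n: "n > 0" "coprime m n" and xmn: "x = of_int m / of_int n"
    by (auto simp: quotient_of_denom_pos quotient_of_coprime quotient_of_div)
  have "d \<noteq> 0"
    using d by auto
  then have "of_int (a * n) = (of_int (m * d) :: rat)"
    using x xmn n by (simp add: field_simps)
  then have "a * n = m * d"
    by (simp only: of_int_eq_iff)
  \<comment> \<open>The reduced denominator \<open>n\<close> is coprime to \<open>m\<close>, so it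
    divides any other denominator \<open>d\<close> of \<open>x\<close>; were \<open>p\<close> to
    divide \<open>n\<close>, it would divide \<open>d\<close>.\<close>
  then have "n dvd m * d"
    by (metis dvd_triv_right)
  then have "n dvd d"
    using n by (simp add: coprime_commute coprime_dvd_mult_right_iff)
  then show "x \<in> p_integral p"
    using d mn by (auto simp: p_integral_def dest: dvd_trans)
qed

lemma p_integral_of_int_divide:
  "\<not> int p dvd d \<Longrightarrow> of_int a / of_int d \<in> p_integral p"
  using p_integral_iff by blast

lemma p_integral_mult:
  assumes "prime p" "x \<in> p_integral p" "y \<in> p_integral p"
  shows "x * y \<in> p_integral p"
proof -
  obtain a d a' d' where "\<not> int p dvd d" "x = of_int a / of_int d"
      "\<not> int p dvd d'" "y = of_int a' / of_int d'"
    using assms p_integral_iff by metis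
  then have "\<not> int p dvd d * d'" "x * y = of_int (a * a') / of_int (d * d')"
    using assms(1) by (simp_all add: prime_dvd_mult_iff)
  then show ?thesis
    using p_integral_of_int_divide by metis
qed

text \<open>Besides the witness \<open>z\<close>, \<open>p_cong\<close> demands that both sides be
  p-integral, hence the closure under products.\<close>

lemma p_cong_power_mult_0:
  assumes "prime p" "z \<in> p_integral p"
  shows "p_cong p r (of_nat p ^ r * z) 0"
proof -
  have "(of_nat p ^ r :: rat) \<in> p_integral p" "(0 :: rat) \<in> p_integral p"
    using p_integral_of_int_divide[of p 1 "int p ^ r"]
      p_integral_of_int_divide[of p 1 0] prime_gt_1_nat[OF assms(1)]
    by simp_all
  then show ?thesis
    using assms p_integral_mult by (auto simp: p_cong_def)
qed

text \<open>No division occurs, so any commutative ring and any coefficients \<open>B\<close> will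
  do. The index is shifted by one against the theorem, so that induction can start at 0, where both
  sides equal \<open>B 0\<close>.\<close>

lemma sum_recurrence_squares:
  fixes B u :: "nat \<Rightarrow> 'a :: comm_ring_1" and c :: 'a
  assumes "u 0 = 1" "u 1 = B 0"
    and rec: "\<And>n. n \<ge> 1 \<Longrightarrow>
      of_nat (n + 1) ^ r * u (n + 1) = B n * u n - c * of_nat n ^ r * u (n - 1)"
  shows "(\<Sum>k=0..n. B k * (- c) ^ (n - k) * (u k)\<^sup>2) = of_nat (n + 1) ^ r * u (n + 1) * u n"
proof (induction n)
  case 0
  show ?case
    using assms(1,2) by simp
next
  case (Suc n)
  have "(\<Sum>k=0..Suc n. B k * (- c) ^ (Suc n - k) * (u k)\<^sup>2)
      = (- c) * (\<Sum>k=0..n. B k * (- c) ^ (n - k) * (u k)\<^sup>2) + B (Suc n) * (u (Suc n))\<^sup>2"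
    by (simp add: sum_distrib_left Suc_diff_le mult_ac flip: sum_negf)
  also have "\<dots> = (B (Suc n) * u (Suc n) - c * of_nat (Suc n) ^ r * u n) * u (Suc n)"
    unfolding Suc.IH by (simp add: algebra_simps power2_eq_square)
  also have "\<dots> = of_nat (Suc n + 1) ^ r * u (Suc n + 1) * u (Suc n)"
    using rec[of "Suc n"] by simp
  finally show ?case .
qed

theorem theorem3p3:
  fixes r :: nat and c :: int and b :: "int poly" and u :: "nat \<Rightarrow> rat"
  assumes "r > 0"
    and "c \<noteq> 0"
    and "\<And>n :: int. poly b (-1 - n) = (-1) ^ r * poly b n"
    and "u 0 = 1"
    and "u 1 = of_int (poly b 0)"
    and "\<And>n :: nat. n \<ge> 1 \<Longrightarrow>
           of_nat (n + 1) ^ r * u (n + 1)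
             = of_int (poly b (int n)) * u n - of_int c * of_nat n ^ r * u (n - 1)"
  shows "(\<forall>n :: nat. n \<ge> 1 \<longrightarrow>
            (\<Sum>k=0..n-1. of_int (poly b (int k)) * (- of_int c) ^ (n - 1 - k) * (u k)\<^sup>2)
              = of_nat n ^ r * u n * u (n - 1))
       \<and> (\<forall>p :: nat. prime p \<longrightarrow> odd p \<longrightarrow> \<not> int p dvd c \<longrightarrow>
            (\<forall>m :: nat. m \<ge> 1 \<longrightarrow> u m \<in> p_integral p) \<longrightarrow>
            p_cong p r
              (\<Sum>k=0..p-1. of_int (poly b (int k)) / (- of_int c) ^ k * (u k)\<^sup>2) 0)"
proof (intro conjI allI impI)
  let ?B = "\<lambda>k. of_int (poly b (int k)) :: rat"
  have sum: "(\<Sum>k=0..n-1. ?B k * (- of_int c) ^ (n - 1 - k) * (u k)\<^sup>2) = of_nat n ^ r * u n * u (n - 1)"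
    if "n \<ge> 1" for n
    using sum_recurrence_squares[of u ?B r "of_int c" "n - 1"] assms(4-6) that by simp
  show "(\<Sum>k=0..n-1. ?B k * (- of_int c) ^ (n - 1 - k) * (u k)\<^sup>2) = of_nat n ^ r * u n * u (n - 1)"
    if "n \<ge> 1" for n
    using that by (rule sum)
  fix p :: nat
  assume p: "prime p" and pc: "\<not> int p dvd c"
    and u_int: "\<forall>m\<ge>1. u m \<in> p_integral p"
  have p2: "p \<ge> 2"
    using p by (rule prime_ge_2_nat)
  \<comment> \<open>\<open>w\<close> is the inverse of (-c)^(p-1), written as a quotient of integers
    to expose its denominator.\<close>
  define w :: rat where "w = of_int 1 / of_int ((- c) ^ (p - 1))"
  have "\<not> int p dvd (- c) ^ (p - 1)"
    using p pc prime_dvd_power[of "int p" "- c" "p - 1"] by auto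
  then have "w \<in> p_integral p"
    unfolding w_def by (rule p_integral_of_int_divide)
  \<comment> \<open>Integrality is assumed only for positive indices; p \<ge> 2 makes p-1 one of
    them.\<close>
  moreover have "u p \<in> p_integral p" "u (p - 1) \<in> p_integral p"
    using u_int p2 by auto
  ultimately have "p_cong p r (of_nat p ^ r * (w * (u p * u (p - 1)))) 0"
    by (intro p_cong_power_mult_0 p_integral_mult p)
  also have "of_nat p ^ r * (w * (u p * u (p - 1)))
      = w * (\<Sum>k=0..p-1. ?B k * (- of_int c) ^ (p - 1 - k) * (u k)\<^sup>2)"
    using sum[of p] p2 by simp
  \<comment> \<open>Since k \<le> p-1, \<open>w\<close> cancels (-c)^(p-1-k) down to 1/(-c)^k; this
    uses that c is nonzero.\<close>
  also have "\<dots> = (\<Sum>k=0..p-1. ?B k / (- of_int c) ^ k * (u k)\<^sup>2)"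
    unfolding sum_distrib_left
    using \<open>c \<noteq> 0\<close> p2 by (intro sum.cong refl) (simp add: w_def field_simps flip: power_add)
  finally show "p_cong p r (\<Sum>k=0..p-1. ?B k / (- of_int c) ^ k * (u k)\<^sup>2) 0" .
qed

end
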